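(* The sets $\mathcal{Y}_2=\{S_\infty,L_2\}$, $\mathcal{N}_{2,1}=\{L_2\}$, $\mathcal{N}_{2,2}=\{S_3,C_2\}$ and $\mathcal{N}_{2,3}=\{S_3,Z_2\}$ form a characterizing collection of winners and losers for size $2$ teams; that is, $\mathcal{Y}_2$ is a winning team, each $\mathcal{N}_{2,i}$ ($1\le i\le3$) is a losing team, and for every team $\mathcal{F}$ of size $2$, either $\mathcal{F}\preceq\mathcal{Y}_2$ or $\mathcal{N}_{2,i}\preceq\mathcal{F}$ for some $i\in\{1,2,3\}$. (Consequently a team of size $2$ is a winner if and only if it is simpler than $\mathcal{Y}_2$.)
   Context: Board and polyominoes. The cells are the translates of the unit square $[0,1]\times[0,1]$ by vectors of $\mathbf{Z}^2$; identify a cell with the vector in $\mathbf{Z}^2$. Two cells are adjacent if they share an edge. A polyomino is a nonempty (finite or infinite) set of cells that is connected through adjacent cells, considered up to congruence (translations, rotations, reflections of the board). Game. Two players, maker (moving first) and breaker, alternately mark previously unmarked cells of the infinite board: in each turn the maker marks 1 cell and the breaker marks 2 cells. For a set $\mathcal{S}$ of finite polyominoes, the maker wins if after finitely many moves he has marked all the cells of a set congruent to some element of $\mathcal{S}$; the breaker wins if she prevents this. $\mathcal{S}$ is a winner (winning) if the maker has a winning strategy. Ancestors. $P\sqsubseteq Q$ ($P$ is an ancestor of $Q$) means that some congruent copy of $P$ is a subset of $Q$. A team is a set of polyominoes no element of which is an ancestor of another element; its size is its number of elements. Unbounded sets. A set of polyominoes is unbounded if it contains an infinite polyomino. If $\mathcal{T}$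 is unbounded and $F_T$ is a finite ancestor of $T$ for each $T\in\mathcal{T}$, then $\{F_T\mid T\in\mathcal{T}\}$ is a bounded restriction of $\mathcal{T}$. An unbounded set is a winner if each of its bounded restrictions is a winner. A set that is not a winner is a loser (losing). Simpler. $\mathcal{S}\preceq\mathcal{T}$ ($\mathcal{S}$ is simpler than $\mathcal{T}$) means that for all $Q\in\mathcal{T}$ there is $P\in\mathcal{S}$ with $P\sqsubseteq Q$. Particular polyominoes (up to congruence): $S_n=\{(0,0),\dots,(n-1,0)\}$; $S_\infty=\{(i,0)\mid i\ge0\}$ (only one end is infinite); $L_2=\{(0,0),(1,0),(0,1)\}$; $C_2=\{(0,0),(1,0),(0,1),(1,1)\}$; $Z_2=\{(0,0),(1,0),(0,1),(1,-1)\}$.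
   Formalization: The single team consisting of the two-way infinite straight line and L_2 is excluded from the claim about teams of size 2: it is a winner, but it is neither simpler than Y_2 nor is any N_{2,i} simpler than it. *)

theory Defs
  imports Main
begin

type_synonym cell = "int \<times> int"

definition adjacent :: "cell \<Rightarrow> cell \<Rightarrow> bool" where
  "adjacent p q \<longleftrightarrow> \<bar>fst p - fst q\<bar> + \<bar>snd p - snd q\<bar> = 1"

definition cell_connected :: "cell set \<Rightarrow> bool" where
  "cell_connected X \<longleftrightarrow>
     (\<forall>p\<in>X. \<forall>q\<in>X. (p, q) \<in> {(u, v). u \<in> X \<and> v \<in> X \<and> adjacent u v}\<^sup>*)"

definition poly_cells :: "cell set \<Rightarrow> bool" where
  "poly_cells X \<longleftrightarrow> X \<noteq> {} \<and> cell_connected X"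

text \<open>The symmetry group of the board, generated by the translations, the quarter turn and
  one reflection. A cell is named by the corner of its square; turning about a corner or about
  the centre of a square changes the action on these names only by a translation.\<close>

inductive board_symmetry :: "(cell \<Rightarrow> cell) \<Rightarrow> bool" where
  translation: "board_symmetry (\<lambda>(x, y). (x + a, y + b))"
| rotation: "board_symmetry (\<lambda>(x, y). (- y, x))"
| reflection: "board_symmetry (\<lambda>(x, y). (- x, y))"
| composition: "board_symmetry f \<Longrightarrow> board_symmetry g \<Longrightarrow> board_symmetry (f \<circ> g)"

definition congruent_cells :: "cell set \<Rightarrow> cell set \<Rightarrow> bool" where
  "congruent_cells X Y \<longleftrightarrow> (\<exists>f. board_symmetry f \<and> Y = f ` X)"

lemma board_symmetry_id: "board_symmetry id"
proof -
  have "(\<lambda>(x, y). (x + 0, y + 0)) = (id :: cell \<Rightarrow> cell)" by auto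
  then show ?thesis using translation[of 0 0] by simp
qed

lemma board_symmetry_inverse:
  assumes "board_symmetry f"
  shows "\<exists>g. board_symmetry g \<and> g \<circ> f = id \<and> f \<circ> g = id"
  using assms
proof induction
  case (translation a b)
  show ?case
    by (rule exI[of _ "\<lambda>(x, y). (x + (- a), y + (- b))"])
      (use board_symmetry.translation[of "- a" "- b"] in \<open>auto simp: fun_eq_iff\<close>)
next
  case rotation
  let ?r = "\<lambda>(x, y). (- y, x) :: cell"
  have "board_symmetry (?r \<circ> (?r \<circ> ?r))"
    by (intro board_symmetry.composition board_symmetry.rotation)
  moreover have "(?r \<circ> (?r \<circ> ?r)) \<circ> ?r = id" "?r \<circ> (?r \<circ> (?r \<circ> ?r)) = id"
    by (auto simp: fun_eq_iff)
  ultimately show ?case by blast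
next
  case reflection
  show ?case
    by (rule exI[of _ "\<lambda>(x, y). (- x, y)"])
      (use board_symmetry.reflection in \<open>auto simp: fun_eq_iff\<close>)
next
  case (composition f g)
  then obtain f' g' where inv: "board_symmetry f'" "f' \<circ> f = id" "f \<circ> f' = id"
    "board_symmetry g'" "g' \<circ> g = id" "g \<circ> g' = id" by blast
  then have "(g' \<circ> f') \<circ> (f \<circ> g) = id" "(f \<circ> g) \<circ> (g' \<circ> f') = id"
    by (metis comp_assoc comp_id)+
  then show ?case using board_symmetry.composition[OF inv(4,1)] by blast
qed

lemma congruent_cells_refl: "congruent_cells X X"
  unfolding congruent_cells_def by (intro exI[of _ id]) (simp add: board_symmetry_id)

lemma congruent_cells_sym: "congruent_cells X Y \<Longrightarrow> congruent_cells Y X"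
proof -
  assume "congruent_cells X Y"
  then obtain f where f: "board_symmetry f" "Y = f ` X" unfolding congruent_cells_def by blast
  obtain g where g: "board_symmetry g" "g \<circ> f = id" using board_symmetry_inverse[OF f(1)] by blast
  have "X = g ` Y" by (simp add: f(2) image_comp g(2))
  then show "congruent_cells Y X" using g(1) unfolding congruent_cells_def by blast
qed

lemma congruent_cells_trans:
  "congruent_cells X Y \<Longrightarrow> congruent_cells Y Z \<Longrightarrow> congruent_cells X Z"
  unfolding congruent_cells_def by (auto simp: image_comp intro: board_symmetry.composition)

quotient_type polyomino = "cell set" / partial: "\<lambda>X Y. poly_cells X \<and> poly_cells Y \<and> congruent_cells X Y"
  morphisms cells_of poly_of
proof (rule part_equivpI)
  have "poly_cells {(0, 0)}" by (simp add: poly_cells_def cell_connected_def)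
  then show "\<exists>X. poly_cells X \<and> poly_cells X \<and> congruent_cells X X"
    using congruent_cells_refl by blast
qed (unfold symp_def transp_def, (blast intro: congruent_cells_sym congruent_cells_trans)+)

lift_definition finite_poly :: "polyomino \<Rightarrow> bool" is finite
proof -
  have "congruent_cells X Y \<Longrightarrow> finite X \<Longrightarrow> finite Y" for X Y
    unfolding congruent_cells_def by blast
  then show "finite X = finite Y" if "poly_cells X \<and> poly_cells Y \<and> congruent_cells X Y" for X Y
    using that congruent_cells_sym by blast
qed

lift_definition copy_within :: "polyomino \<Rightarrow> cell set \<Rightarrow> bool"
  is "\<lambda>X A. \<exists>Y. congruent_cells X Y \<and> Y \<subseteq> A"
proof (rule ext)
  show "(\<exists>Y. congruent_cells X Y \<and> Y \<subseteq> A) \<longleftrightarrow> (\<exists>Y. congruent_cells X' Y \<and> Y \<subseteq> A)"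
    if "poly_cells X \<and> poly_cells X' \<and> congruent_cells X X'" for X X' A
  proof -
    have "congruent_cells X Y \<longleftrightarrow> congruent_cells X' Y" for Y
      using that congruent_cells_sym congruent_cells_trans by blast
    then show ?thesis by simp
  qed
qed

lift_definition ancestor :: "polyomino \<Rightarrow> polyomino \<Rightarrow> bool" (infix "\<sqsubseteq>" 50)
  is "\<lambda>X Z. \<exists>Y. congruent_cells X Y \<and> Y \<subseteq> Z"
proof -
  have *: "\<exists>Y. congruent_cells X' Y \<and> Y \<subseteq> Z'"
    if c: "congruent_cells X X'" "congruent_cells Z Z'" "congruent_cells X Y" "Y \<subseteq> Z"
    for X X' Y Z Z'
  proof -
    obtain f where f: "board_symmetry f" "Z' = f ` Z"
      using c(2) congruent_cells_def by blast
    have "congruent_cells Y (f ` Y)" using f(1) congruent_cells_def by blast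
    then have "congruent_cells X' (f ` Y)"
      using c(1,3) congruent_cells_sym congruent_cells_trans by blast
    then show ?thesis using f(2) c(4) by blast
  qed
  show "(\<exists>Y. congruent_cells X Y \<and> Y \<subseteq> Z) \<longleftrightarrow> (\<exists>Y. congruent_cells X' Y \<and> Y \<subseteq> Z')"
    if "poly_cells X \<and> poly_cells X' \<and> congruent_cells X X'"
      "poly_cells Z \<and> poly_cells Z' \<and> congruent_cells Z Z'" for X X' Z Z'
    using that by (meson * congruent_cells_sym)
qed

definition team :: "polyomino set \<Rightarrow> bool" where
  "team F \<longleftrightarrow> (\<forall>P\<in>F. \<forall>Q\<in>F. P \<noteq> Q \<longrightarrow> \<not> P \<sqsubseteq> Q)"

definition simpler :: "polyomino set \<Rightarrow> polyomino set \<Rightarrow> bool" (infix "\<preceq>" 50) where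
  "S \<preceq> T \<longleftrightarrow> (\<forall>Q\<in>T. \<exists>P\<in>S. P \<sqsubseteq> Q)"

text \<open>In round \<open>n\<close> the maker marks the cell \<open>m n\<close> and then the breaker marks the two cells of
  \<open>b n\<close>. A strategy for the maker chooses his cell from the list of all completed rounds.\<close>

type_synonym maker_strategy = "(cell \<times> cell set) list \<Rightarrow> cell"

definition marked :: "(nat \<Rightarrow> cell) \<Rightarrow> (nat \<Rightarrow> cell set) \<Rightarrow> nat \<Rightarrow> cell set" where
  "marked m b n = (\<Union>k<n. insert (m k) (b k))"

definition follows :: "(nat \<Rightarrow> cell) \<Rightarrow> (nat \<Rightarrow> cell set) \<Rightarrow> maker_strategy \<Rightarrow> bool" where
  "follows m b \<sigma> \<longleftrightarrow> (\<forall>n. m n = \<sigma> (map (\<lambda>k. (m k, b k)) [0..<n]))"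

definition maker_legal :: "(nat \<Rightarrow> cell) \<Rightarrow> (nat \<Rightarrow> cell set) \<Rightarrow> bool" where
  "maker_legal m b \<longleftrightarrow> (\<forall>n. m n \<notin> marked m b n)"

definition breaker_legal :: "(nat \<Rightarrow> cell) \<Rightarrow> (nat \<Rightarrow> cell set) \<Rightarrow> bool" where
  "breaker_legal m b \<longleftrightarrow> (\<forall>n. card (b n) = 2 \<and> b n \<inter> insert (m n) (marked m b n) = {})"

text \<open>Plays are continued forever, also after the maker has achieved his goal. As the board is
  infinite, legal moves always exist, so this does not affect who wins.\<close>

definition maker_wins :: "polyomino set \<Rightarrow> bool" where
  "maker_wins S \<longleftrightarrow>
     (\<exists>\<sigma>. \<forall>m b. follows m b \<sigma> \<and> breaker_legal m b \<longrightarrow>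
        maker_legal m b \<and> (\<exists>n. \<exists>P\<in>S. copy_within P (m ` {..<n})))"

definition unbounded :: "polyomino set \<Rightarrow> bool" where
  "unbounded S \<longleftrightarrow> (\<exists>P\<in>S. \<not> finite_poly P)"

definition bounded_restriction :: "polyomino set \<Rightarrow> polyomino set \<Rightarrow> bool" where
  "bounded_restriction R T \<longleftrightarrow>
     (\<exists>F. (\<forall>P\<in>T. finite_poly (F P) \<and> F P \<sqsubseteq> P) \<and> R = F ` T)"

definition winner :: "polyomino set \<Rightarrow> bool" where
  "winner S \<longleftrightarrow>
     (if unbounded S then \<forall>R. bounded_restriction R S \<longrightarrow> maker_wins R else maker_wins S)"

abbreviation loser :: "polyomino set \<Rightarrow> bool" where
  "loser S \<equiv> \<not> winner S"

text \<open>The value of \<open>poly_of\<close> is meaningful only on sets satisfying \<^const>\<open>poly_cells\<close>; the lemmas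
  below check this for the polyominoes defined here (for \<open>S_poly n\<close> if \<open>n \<ge> 1\<close>).\<close>

definition S_poly :: "nat \<Rightarrow> polyomino" where
  "S_poly n = poly_of {(i, 0) | i. 0 \<le> i \<and> i < int n}"

definition S_inf :: polyomino where
  "S_inf = poly_of {(i, 0) | i. 0 \<le> i}"

text \<open>The line with two infinite ends. It is not an ancestor of \<^const>\<open>S_inf\<close>, though both have
  the same finite ancestors. Hence the team formed by it and \<open>L2\<close> is a winner exactly like
  \<open>{S_inf, L2}\<close>, but it is not simpler than that team.\<close>

definition S_biinf :: polyomino where
  "S_biinf = poly_of {(i, 0) | i. True}"

definition L2 :: polyomino where
  "L2 = poly_of {(0, 0), (1, 0), (0, 1)}"

definition C2 :: polyomino where
  "C2 = poly_of {(0, 0), (1, 0), (0, 1), (1, 1)}"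

definition Z2 :: polyomino where
  "Z2 = poly_of {(0, 0), (1, 0), (0, 1), (1, -1)}"

lemma poly_cells_from_root:
  assumes r: "r \<in> X"
    and step: "\<And>p. p \<in> X \<Longrightarrow> (r, p) \<in> {(u, v). u \<in> X \<and> v \<in> X \<and> adjacent u v}\<^sup>*"
  shows "poly_cells X"
proof -
  let ?E = "{(u, v). u \<in> X \<and> v \<in> X \<and> adjacent u v}"
  have "sym ?E" by (auto simp: sym_def adjacent_def)
  then have "sym (?E\<^sup>*)" by (rule sym_rtrancl)
  then have "(p, q) \<in> ?E\<^sup>*" if "p \<in> X" "q \<in> X" for p q
    using step[OF that(1)] step[OF that(2)] by (meson symD rtrancl_trans)
  then show ?thesis using r by (auto simp: poly_cells_def cell_connected_def)
qed

lemma poly_cells_row: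
  assumes "0 \<in> I" and conv: "\<And>i j. i \<in> I \<Longrightarrow> 0 \<le> j \<and> j \<le> i \<or> i \<le> j \<and> j \<le> 0 \<Longrightarrow> j \<in> I"
  shows "poly_cells {(i, 0) | i. i \<in> I}"
proof (rule poly_cells_from_root[of "(0, 0)"])
  let ?X = "{(i, 0 :: int) | i. i \<in> I}"
  let ?E = "{(u, v). u \<in> ?X \<and> v \<in> ?X \<and> adjacent u v}"
  show "(0, 0) \<in> ?X" using assms(1) by simp
  have pos: "int k \<in> I \<Longrightarrow> ((0, 0), (int k, 0)) \<in> ?E\<^sup>*" for k
  proof (induction k)
    case (Suc k)
    then have k: "int k \<in> I" using conv[of "int (Suc k)" "int k"] by simp
    then have "((int k, 0), (int (Suc k), 0)) \<in> ?E" using Suc.prems by (simp add: adjacent_def)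
    then show ?case using Suc.IH[OF k] by (rule rtrancl_into_rtrancl[rotated])
  qed simp
  have neg: "- int k \<in> I \<Longrightarrow> ((0, 0), (- int k, 0)) \<in> ?E\<^sup>*" for k
  proof (induction k)
    case (Suc k)
    then have k: "- int k \<in> I" using conv[of "- int (Suc k)" "- int k"] by simp
    then have "((- int k, 0), (- int (Suc k), 0)) \<in> ?E" using Suc.prems by (simp add: adjacent_def)
    then show ?case using Suc.IH[OF k] by (rule rtrancl_into_rtrancl[rotated])
  qed simp
  show "((0, 0), p) \<in> ?E\<^sup>*" if p: "p \<in> ?X" for p
  proof -
    obtain i where i: "p = (i, 0)" "i \<in> I" using p by blast
    then show ?thesis by (cases i rule: int_cases2) (use pos neg in auto)
  qed
qed

lemma poly_cells_S_poly: "n \<ge> 1 \<Longrightarrow> poly_cells {(i, 0) | i. 0 \<le> i \<and> i < int n}"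
  by (rule poly_cells_row[of "{i. 0 \<le> i \<and> i < int n}", simplified mem_Collect_eq]) auto

lemma poly_cells_S_inf: "poly_cells {(i, 0) | i. 0 \<le> i}"
  by (rule poly_cells_row[of "{i. 0 \<le> i}", simplified mem_Collect_eq]) auto

lemma poly_cells_S_biinf: "poly_cells {(i, 0) | i. True}"
  using poly_cells_row[of UNIV] by auto

lemma poly_cells_L2: "poly_cells {(0, 0), (1, 0), (0, 1)}"
  by (rule poly_cells_from_root[of "(0, 0)"]) (auto simp: adjacent_def)

lemma poly_cells_C2: "poly_cells {(0, 0), (1, 0), (0, 1), (1, 1)}" (is "poly_cells ?X")
proof (rule poly_cells_from_root[of "(0, 0)"])
  let ?E = "{(u, v). u \<in> ?X \<and> v \<in> ?X \<and> adjacent u v}"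
  have "((0, 0), (1, 0)) \<in> ?E" "((1, 0), (1, 1)) \<in> ?E" "((0, 0), (0, 1)) \<in> ?E"
    by (simp_all add: adjacent_def)
  then have "((0, 0), (1, 0)) \<in> ?E\<^sup>*" "((0, 0), (1, 1)) \<in> ?E\<^sup>*" "((0, 0), (0, 1)) \<in> ?E\<^sup>*"
    by (meson r_into_rtrancl rtrancl_into_rtrancl)+
  then show "((0, 0), p) \<in> ?E\<^sup>*" if "p \<in> ?X" for p
    using that by (elim insertE) simp_all
qed simp

lemma poly_cells_Z2: "poly_cells {(0, 0), (1, 0), (0, 1), (1, -1)}" (is "poly_cells ?X")
proof (rule poly_cells_from_root[of "(0, 0)"])
  let ?E = "{(u, v). u \<in> ?X \<and> v \<in> ?X \<and> adjacent u v}"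
  have "((0, 0), (1, 0)) \<in> ?E" "((1, 0), (1, -1)) \<in> ?E" "((0, 0), (0, 1)) \<in> ?E"
    by (simp_all add: adjacent_def)
  then have "((0, 0), (1, 0)) \<in> ?E\<^sup>*" "((0, 0), (1, -1)) \<in> ?E\<^sup>*" "((0, 0), (0, 1)) \<in> ?E\<^sup>*"
    by (meson r_into_rtrancl rtrancl_into_rtrancl)+
  then show "((0, 0), p) \<in> ?E\<^sup>*" if "p \<in> ?X" for p
    using that by (elim insertE) simp_all
qed simp

definition Y_2 :: "polyomino set" where "Y_2 = {S_inf, L2}"
definition N_2_1 :: "polyomino set" where "N_2_1 = {L2}"
definition N_2_2 :: "polyomino set" where "N_2_2 = {S_poly 3, C2}"
definition N_2_3 :: "polyomino set" where "N_2_3 = {S_poly 3, Z2}"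

end

theory Submission
  imports Defs
begin

text \<open>
  Both players have simple strategies. The maker prolongs a straight line, each step threatening so
  many L-trominoes that all marks of the breaker are used up beside the line. The breaker fixes a
  graph of degree at most 2 on the cells such that every copy of a member of the losing set contains
  an edge, and answers each move of the maker by marking the neighbours of his cell: vertical
  lines for \<^const>\<open>L2\<close>, unions of a horizontal and a vertical perfect matching for the other two.
  The rest is a classification: a polyomino without an L-tromino is straight, and a polyomino that
  properly contains one contains \<^term>\<open>S_poly 3\<close>, \<^const>\<open>C2\<close> or \<^const>\<open>Z2\<close>.
\<close>

section \<open>Symmetries and copies\<close>

definition unit_vectors :: "cell set" where
  "unit_vectors = {(1, 0), (-1, 0), (0, 1), (0, -1)}"

lemma unit_vectors_cases:
  assumes "(c, d) \<in> unit_vectors"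
  obtains "c = 1" "d = 0" | "c = -1" "d = 0" | "c = 0" "d = 1" | "c = 0" "d = -1"
  using assms unfolding unit_vectors_def by auto

lemma sign_cases:
  assumes "s \<in> {1, -1 :: int}"
  obtains "s = 1" | "s = -1"
  using assms by auto

text \<open>The isometry that sends the origin to \<open>(a, b)\<close> and the first basis vector to \<open>(c, d)\<close>; it
  preserves the orientation if \<open>s = 1\<close> and reverses it if \<open>s = -1\<close>.\<close>

definition frame_map :: "int \<Rightarrow> int \<Rightarrow> int \<Rightarrow> int \<Rightarrow> int \<Rightarrow> cell \<Rightarrow> cell" where
  "frame_map a b c d s = (\<lambda>(x, y). (a + c * x - s * d * y, b + d * x + s * c * y))"

text \<open>Reduces symmetries to integers: the linear part has only eight possibilities, given by
  \<open>(c, d)\<close> and \<open>s\<close>, which later proofs enumerate.\<close>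

lemma board_symmetry_imp_frame_map:
  assumes "board_symmetry f"
  shows "\<exists>a b c d s. (c, d) \<in> unit_vectors \<and> s \<in> {1, -1} \<and> f = frame_map a b c d s"
  using assms
proof induction
  case (translation a b)
  show ?case
    by (intro exI[of _ a] exI[of _ b] exI[of _ 1] exI[of _ 0] exI[of _ 1])
      (auto simp: frame_map_def unit_vectors_def fun_eq_iff)
next
  case rotation
  show ?case
    by (intro exI[of _ 0] exI[of _ 0] exI[of _ 0] exI[of _ 1] exI[of _ 1])
      (auto simp: frame_map_def unit_vectors_def fun_eq_iff)
next
  case reflection
  show ?case
    by (intro exI[of _ 0] exI[of _ 0] exI[of _ "-1"] exI[of _ 0] exI[of _ "-1"])
      (auto simp: frame_map_def unit_vectors_def fun_eq_iff)
next
  case (composition f g)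
  then obtain a b c d s a' b' c' d' s' where
    f: "(c, d) \<in> unit_vectors" "s \<in> {1, -1}" "f = frame_map a b c d s" and
    g: "(c', d') \<in> unit_vectors" "s' \<in> {1, -1}" "g = frame_map a' b' c' d' s'" by metis
  \<comment> \<open>The linear part of \<open>f\<close> applied to \<open>(c', d')\<close>, hence
    the image of the first basis vector under the linear part of the composition.\<close>
  have u: "(c * c' - s * d * d', d * c' + s * c * d') \<in> unit_vectors"
    using f(1,2) g(1) unfolding unit_vectors_def by (elim insertE emptyE) simp_all
  have s: "s * s' \<in> {1, -1}"
    using f(2) g(2) by auto
  have "f \<circ> g = frame_map (a + c * a' - s * d * b') (b + d * a' + s * c * b')
      (c * c' - s * d * d') (d * c' + s * c * d') (s * s')"
    using f(2) unfolding f(3) g(3)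
    by (elim insertE) (simp_all add: frame_map_def fun_eq_iff algebra_simps)
  with u s show ?case by (intro exI conjI)
qed

text \<open>Quarter turns of the identity and of the reflection, which is
  \<open>frame_map 0 0 (-1) 0 (-1)\<close>, reach all eight linear parts; a translation then moves
  the origin to \<open>(a, b)\<close>.\<close>

lemma board_symmetry_frame_map:
  assumes "(c, d) \<in> unit_vectors" "s \<in> {1, -1}"
  shows "board_symmetry (frame_map a b c d s)"
proof -
  let ?r = "(\<lambda>(x, y). (- y, x)) :: cell \<Rightarrow> cell"
  have 1: "board_symmetry (frame_map 0 0 1 0 1)"
    using board_symmetry_id by (simp add: frame_map_def id_def case_prod_unfold)
  have 2: "board_symmetry (frame_map 0 0 (-1) 0 (-1))"
    using reflection by (simp add: frame_map_def)
  have turn: "board_symmetry (frame_map 0 0 (-d) c s)" if "board_symmetry (frame_map 0 0 c d s)" for c d s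
  proof -
    have "frame_map 0 0 (-d) c s = ?r \<circ> frame_map 0 0 c d s"
      by (auto simp: frame_map_def fun_eq_iff)
    then show ?thesis using composition[OF rotation that] by simp
  qed
  have start: "board_symmetry (frame_map 0 0 1 0 s)"
  proof (cases "s = 1")
    case False
    then have "s = -1" using assms(2) by simp
    then show ?thesis using turn[OF turn[OF 2]] by simp
  qed (use 1 in simp)
  from turn[OF this] have t1: "board_symmetry (frame_map 0 0 0 1 s)" by simp
  from turn[OF this] have t2: "board_symmetry (frame_map 0 0 (-1) 0 s)" by simp
  from turn[OF this] have t3: "board_symmetry (frame_map 0 0 0 (-1) s)" by simp
  have "c = 1 \<and> d = 0 \<or> c = 0 \<and> d = 1 \<or> c = -1 \<and> d = 0 \<or> c = 0 \<and> d = -1"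
    using assms(1) by (auto simp: unit_vectors_def)
  then have "board_symmetry (frame_map 0 0 c d s)"
    using start t1 t2 t3 by metis
  from composition[OF translation[of a b] this]
  have "board_symmetry ((\<lambda>(x, y). (x + a, y + b)) \<circ> frame_map 0 0 c d s)" .
  moreover have "(\<lambda>(x, y). (x + a, y + b)) \<circ> frame_map 0 0 c d s = frame_map a b c d s"
    by (auto simp: frame_map_def fun_eq_iff)
  ultimately show ?thesis by simp
qed

section \<open>Congruent copies as embeddings of cell sets\<close>

definition embeds :: "cell set \<Rightarrow> cell set \<Rightarrow> bool" where
  "embeds X A \<longleftrightarrow> (\<exists>f. board_symmetry f \<and> f ` X \<subseteq> A)"

lemma embedsI: "board_symmetry f \<Longrightarrow> f ` X \<subseteq> A \<Longrightarrow> embeds X A"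
  by (auto simp: embeds_def)

lemma embeds_frameI:
  "(c, d) \<in> unit_vectors \<Longrightarrow> s \<in> {1, -1} \<Longrightarrow> frame_map a b c d s ` X \<subseteq> A \<Longrightarrow> embeds X A"
  by (rule embedsI[OF board_symmetry_frame_map])

lemma embedsE:
  assumes "embeds X A"
  obtains a b c d s where "(c, d) \<in> unit_vectors" "s \<in> {1, -1}" "frame_map a b c d s ` X \<subseteq> A"
  using assms board_symmetry_imp_frame_map unfolding embeds_def by metis

lemma embeds_subset: "X \<subseteq> A \<Longrightarrow> embeds X A"
  by (rule embedsI[OF board_symmetry_id]) simp

lemma embeds_trans: "embeds X Y \<Longrightarrow> embeds Y Z \<Longrightarrow> embeds X Z"
proof -
  assume "embeds X Y" "embeds Y Z"
  then obtain f g where "board_symmetry f" "f ` X \<subseteq> Y" "board_symmetry g" "g ` Y \<subseteq> Z"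
    by (auto simp: embeds_def)
  then show "embeds X Z"
    by (intro embedsI[OF board_symmetry.composition[of g f]]) auto
qed

lemma congruent_cells_image: "board_symmetry f \<Longrightarrow> congruent_cells X (f ` X)"
  unfolding congruent_cells_def by blast

lemma congruent_imp_embeds: "congruent_cells X Y \<Longrightarrow> embeds X Y"
  by (auto simp: congruent_cells_def embeds_def)

lemma embeds_iff: "(\<exists>Y. congruent_cells X Y \<and> Y \<subseteq> A) \<longleftrightarrow> embeds X A"
  by (auto simp: congruent_cells_def embeds_def)

lemma polyomino_cases:
  obtains X where "poly_cells X" "P = poly_of X"
  using Quotient3_abs_rep[OF Quotient3_polyomino] Quotient3_rep_reflp[OF Quotient3_polyomino]
  by metis

lemma poly_of_eqI: "poly_cells X \<Longrightarrow> poly_cells Y \<Longrightarrow> congruent_cells X Y \<Longrightarrow> poly_of X = poly_of Y"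
  using Quotient3_rel_abs[OF Quotient3_polyomino] by metis

lemma ancestor_poly_of:
  "poly_cells X \<Longrightarrow> poly_cells Z \<Longrightarrow> poly_of X \<sqsubseteq> poly_of Z \<longleftrightarrow> embeds X Z"
  using ancestor.abs_eq[of X Z] congruent_cells_refl by (simp add: eq_onp_def embeds_iff)

lemma copy_within_poly_of: "poly_cells X \<Longrightarrow> copy_within (poly_of X) A \<longleftrightarrow> embeds X A"
  using copy_within.abs_eq[of X] congruent_cells_refl by (simp add: eq_onp_def embeds_iff)

lemma finite_poly_poly_of: "poly_cells X \<Longrightarrow> finite_poly (poly_of X) \<longleftrightarrow> finite X"
  using finite_poly.abs_eq[of X] congruent_cells_refl by (simp add: eq_onp_def)

lemma copy_within_ancestor: "P \<sqsubseteq> Q \<Longrightarrow> copy_within Q A \<Longrightarrow> copy_within P A"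
  by (cases P rule: polyomino_cases; cases Q rule: polyomino_cases)
    (auto simp: ancestor_poly_of copy_within_poly_of intro: embeds_trans)

lemma ancestor_trans: "P \<sqsubseteq> Q \<Longrightarrow> Q \<sqsubseteq> R \<Longrightarrow> P \<sqsubseteq> R"
  by (cases P rule: polyomino_cases; cases Q rule: polyomino_cases; cases R rule: polyomino_cases)
    (auto simp: ancestor_poly_of intro: embeds_trans)

lemma ancestor_refl: "P \<sqsubseteq> P"
  by (cases P rule: polyomino_cases) (auto simp: ancestor_poly_of intro: embeds_subset)

text \<open>The index set is a parameter so that finite lines, the half-line and the line with two
  infinite ends share their lemmas.\<close>

definition row :: "int set \<Rightarrow> cell set" where
  "row I = {(i, 0) | i. i \<in> I}"

abbreviation L_cells :: "cell set" where "L_cells \<equiv> {(0, 0), (1, 0), (0, 1)}"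
abbreviation C_cells :: "cell set" where "C_cells \<equiv> {(0, 0), (1, 0), (0, 1), (1, 1)}"
abbreviation Z_cells :: "cell set" where "Z_cells \<equiv> {(0, 0), (1, 0), (0, 1), (1, -1)}"

lemma row_3: "row {0..<3} = {(0, 0), (1, 0), (2, 0)}"
proof -
  have "{0..<3} = {0, 1, 2 :: int}" by auto
  then show ?thesis by (auto simp: row_def)
qed

lemma frame_map_row: "frame_map a b c d s ` row I = {(a + c * i, b + d * i) | i. i \<in> I}"
  by (auto simp: row_def frame_map_def image_iff)

lemma poly_defs:
  "S_poly n = poly_of (row {0..<int n})" "S_inf = poly_of (row {0..})" "S_biinf = poly_of (row UNIV)"
  "L2 = poly_of L_cells" "C2 = poly_of C_cells" "Z2 = poly_of Z_cells"
  by (auto simp: S_poly_def S_inf_def S_biinf_def L2_def C2_def Z2_def row_def intro!: arg_cong[of _ _ poly_of])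

lemma poly_cells_rows:
  "n \<ge> 1 \<Longrightarrow> poly_cells (row {0..<int n})" "poly_cells (row {0..})" "poly_cells (row UNIV)"
  using poly_cells_S_poly[of n] poly_cells_S_inf poly_cells_S_biinf by (auto simp: row_def)

lemma poly_cells_row_3: "poly_cells (row {0..<3})"
  using poly_cells_rows(1)[of 3] by simp

lemma S_poly_3: "S_poly 3 = poly_of (row {0..<3})"
  by (simp add: poly_defs)

lemmas cells_facts = poly_cells_rows poly_cells_row_3 poly_cells_L2 poly_cells_C2 poly_cells_Z2

section \<open>Pairing strategies of the breaker\<close>

text \<open>The breaker must mark exactly two free cells, so a reply \<open>R\<close> that is partly
  marked already is padded with arbitrary cells from the infinite rest of the board.\<close>

lemma ex_breaker_move:
  fixes A R :: "cell set"
  assumes "finite A" "finite R" "card R \<le> 2"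
  shows "\<exists>B. card B = 2 \<and> B \<inter> A = {} \<and> R - A \<subseteq> B"
proof -
  have "infinite (UNIV :: cell set)" by (simp add: finite_prod)
  then have inf: "infinite (- (A \<union> R))" using assms(1,2) by (simp add: Compl_eq_Diff_UNIV)
  obtain T where T: "T \<subseteq> - (A \<union> R)" "card T = 2 - card (R - A)" "finite T"
    using infinite_arbitrarily_large[OF inf] by metis
  have "card (R - A) \<le> 2" using assms(2,3) by (meson card_mono Diff_subset le_trans)
  then have "card ((R - A) \<union> T) = 2"
    using T assms(2) by (subst card_Un_disjoint) auto
  then show ?thesis using T(1) by (intro exI[of _ "(R - A) \<union> T"]) auto
qed

text \<open>When the maker marks the first of two cells lying in each other's reply
  \<open>r\<close>, the breaker takes the other at once unless she has it already, so he never owns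
  both.\<close>

lemma pairing_not_maker_wins:
  fixes r :: "cell \<Rightarrow> cell set"
  assumes r: "\<And>c. finite (r c)" "\<And>c. card (r c) \<le> 2"
    and pair: "\<And>P A. P \<in> S \<Longrightarrow> copy_within P A \<Longrightarrow> \<exists>x\<in>A. \<exists>y\<in>A. x \<noteq> y \<and> x \<in> r y \<and> y \<in> r x"
  shows "\<not> maker_wins S"
proof
  assume "maker_wins S"
  then obtain \<sigma> where \<sigma>: "\<And>m b. follows m b \<sigma> \<Longrightarrow> breaker_legal m b \<Longrightarrow>
      maker_legal m b \<and> (\<exists>n. \<exists>P\<in>S. copy_within P (m ` {..<n}))"
    unfolding maker_wins_def by blast
  define used :: "(cell \<times> cell set) list \<Rightarrow> cell set" where
    "used h = (\<Union>(p, B)\<in>set h. insert p B)" for h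
  define move where "move h = (SOME B. card B = 2 \<and> B \<inter> insert (\<sigma> h) (used h) = {}
      \<and> r (\<sigma> h) - insert (\<sigma> h) (used h) \<subseteq> B)" for h
  \<comment> \<open>The play of \<open>\<sigma>\<close> against \<open>move\<close>; both choose
    from the history alone, so it is determined.\<close>
  define hist where "hist n = ((\<lambda>h. h @ [(\<sigma> h, move h)]) ^^ n) []" for n
  define m b where "m n = \<sigma> (hist n)" and "b n = move (hist n)" for n
  have hist_Suc: "hist (Suc n) = hist n @ [(m n, b n)]" for n
    by (simp add: hist_def m_def b_def)
  have hist: "hist n = map (\<lambda>k. (m k, b k)) [0..<n]" for n
    by (induction n) (simp_all add: hist_Suc, simp add: hist_def)
  have used: "used (hist n) = marked m b n" for n
    by (auto simp: used_def marked_def hist)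
  have fin: "finite (marked m b n)" if "\<And>k. k < n \<Longrightarrow> card (b k) = 2" for n
    unfolding marked_def using that by (auto intro: card_ge_0_finite)
  have b: "card (b n) = 2 \<and> b n \<inter> insert (m n) (marked m b n) = {}
      \<and> r (m n) - insert (m n) (marked m b n) \<subseteq> b n" for n
  \<comment> \<open>Strong induction: a legal reply exists because only finitely many cells are
    marked, which rests on the sizes of all earlier replies.\<close>
  proof (induction n rule: less_induct)
    case (less n)
    have "finite (insert (m n) (marked m b n))" using fin less by simp
    note someI_ex[OF ex_breaker_move[OF this r, of "m n"]]
    moreover have "b n = (SOME B. card B = 2 \<and> B \<inter> insert (m n) (marked m b n) = {}
        \<and> r (m n) - insert (m n) (marked m b n) \<subseteq> B)"
      by (simp only: b_def[of n] m_def[of n] move_def used)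
    ultimately show ?case by (simp only:)
  qed
  have "follows m b \<sigma>" unfolding follows_def hist[symmetric] using m_def by simp
  moreover have "breaker_legal m b" unfolding breaker_legal_def using b by blast
  ultimately obtain n P where legal: "maker_legal m b" and P: "P \<in> S" "copy_within P (m ` {..<n})"
    using \<sigma> by blast
  have no_pair: False if "i < j" "m j \<in> r (m i)" for i j
  proof -
    have "m j \<in> insert (m i) (marked m b i) \<union> b i" using b[of i] that(2) by blast
    also have "\<dots> \<subseteq> marked m b j" using that(1) by (force simp: marked_def)
    finally show False using legal by (simp add: maker_legal_def)
  qed
  from pair[OF P] obtain i j where "m i \<noteq> m j" "m i \<in> r (m j)" "m j \<in> r (m i)" by blast
  then show False using no_pair[of i j] no_pair[of j i] by (metis nat_neq_iff)
qed

text \<open>Every L-tromino contains two vertically adjacent cells, so the replies are the cell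
  above and the cell below.\<close>

lemma not_maker_wins_N_2_1: "\<not> maker_wins N_2_1"
proof (rule pairing_not_maker_wins)
  let ?r = "\<lambda>(u, v). {(u, v + 1), (u, v - 1)}"
  fix P A assume "P \<in> N_2_1" "copy_within P A"
  then have "embeds L_cells A"
    using poly_cells_L2 by (simp add: N_2_1_def poly_defs copy_within_poly_of)
  then obtain a b c d s where *: "(c, d) \<in> unit_vectors" "s \<in> {1, -1}"
      "frame_map a b c d s ` L_cells \<subseteq> A"
    by (elim embedsE)
  show "\<exists>x\<in>A. \<exists>y\<in>A. x \<noteq> y \<and> x \<in> ?r y \<and> y \<in> ?r x"
  proof (rule ccontr)
    assume "\<not> ?thesis"
    then have no: False if "x \<in> A" "y \<in> A" "x \<noteq> y" "x \<in> ?r y" "y \<in> ?r x" for x y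
      using that by blast
    have no': "(u, v + 1) \<notin> A" "(u, v - 1) \<notin> A" if "(u, v) \<in> A" for u v
      using no[OF that, of "(u, v + 1)"] no[OF that, of "(u, v - 1)"] by auto
    show False using *
      unfolding unit_vectors_def by (elim insertE emptyE) (auto simp: frame_map_def dest: no')
  qed
qed (auto simp: card_insert_if)

text \<open>The involution of the integers that exchanges \<open>2k\<close> and
  \<open>2k + 1\<close>.\<close>

definition flip :: "int \<Rightarrow> int" where
  "flip x = (if even x then x + 1 else x - 1)"

text \<open>The breaker cuts the board into \<open>2 \<times> 2\<close> blocks and answers with the two neighbours in the
  block. Every three cells in a row contain two neighbours in a block, and of the two parallel
  outer dominoes of \<^const>\<open>Z2\<close> exactly one lies in a block.\<close>

lemma not_maker_wins_N_2_3: "\<not> maker_wins N_2_3"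
proof (rule pairing_not_maker_wins)
  let ?r = "\<lambda>(u, v). {(flip u, v), (u, flip v)}"
  fix P A assume "P \<in> N_2_3" "copy_within P A"
  then have "embeds (row {0..<3}) A \<or> embeds Z_cells A"
    using cells_facts by (auto simp: N_2_3_def poly_defs(6) S_poly_3 copy_within_poly_of)
  then obtain a b c d s where *: "(c, d) \<in> unit_vectors" "s \<in> {1, -1}"
      "frame_map a b c d s ` row {0..<3} \<subseteq> A \<or> frame_map a b c d s ` Z_cells \<subseteq> A"
    by (elim disjE embedsE) blast+
  show "\<exists>x\<in>A. \<exists>y\<in>A. x \<noteq> y \<and> x \<in> ?r y \<and> y \<in> ?r x"
  proof (rule ccontr)
    assume "\<not> ?thesis"
    then have no: False if "x \<in> A" "y \<in> A" "x \<noteq> y" "x \<in> ?r y" "y \<in> ?r x" for x y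
      using that by blast
    \<comment> \<open>Adjacent cells of \<open>A\<close> that are not partners are separated by a
      block boundary, which fixes the parity of a coordinate.\<close>
    have no': "(u, v) \<in> A \<Longrightarrow> (u + 1, v) \<in> A \<Longrightarrow> odd u"
      "(u, v) \<in> A \<Longrightarrow> (u, v + 1) \<in> A \<Longrightarrow> odd v"
      "(u, v) \<in> A \<Longrightarrow> (u - 1, v) \<in> A \<Longrightarrow> even u"
      "(u, v) \<in> A \<Longrightarrow> (u, v - 1) \<in> A \<Longrightarrow> even v" for u v
      by (rule ccontr, erule (1) no; simp add: flip_def)+
    \<comment> \<open>\<open>(a, b)\<close> is the image of the origin; the parities at this cell
      and its four neighbours refute all sixteen placements.\<close>
    note nos = no'[of a b, simplified] no'[of "a + 1" b, simplified] no'[of "a - 1" b, simplified]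
      no'[of a "b + 1", simplified] no'[of a "b - 1", simplified]
    show False
      by (rule disjE[OF *(3)]; rule unit_vectors_cases[OF *(1)]; rule sign_cases[OF *(2)];
          simp add: row_3 frame_map_def; insert nos; simp add: ac_simps)
  qed
qed (auto simp: card_insert_if)

text \<open>Here the horizontal pairs are shifted by one cell in every other row, like bricks in a wall,
  so that every \<^const>\<open>C2\<close> contains exactly one of them.\<close>

lemma not_maker_wins_N_2_2: "\<not> maker_wins N_2_2"
proof (rule pairing_not_maker_wins)
  \<comment> \<open>Pairing by \<open>u + v\<close> instead of \<open>u\<close> shifts the
    horizontal pairs by one from row to row.\<close>
  let ?r = "\<lambda>(u, v). {(flip (u + v) - v, v), (u, flip v)}"
  fix P A assume "P \<in> N_2_2" "copy_within P A"
  then have "embeds (row {0..<3}) A \<or> embeds C_cells A"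
    using cells_facts by (auto simp: N_2_2_def poly_defs(5) S_poly_3 copy_within_poly_of)
  then obtain a b c d s where *: "(c, d) \<in> unit_vectors" "s \<in> {1, -1}"
      "frame_map a b c d s ` row {0..<3} \<subseteq> A \<or> frame_map a b c d s ` C_cells \<subseteq> A"
    by (elim disjE embedsE) blast+
  show "\<exists>x\<in>A. \<exists>y\<in>A. x \<noteq> y \<and> x \<in> ?r y \<and> y \<in> ?r x"
  proof (rule ccontr)
    assume "\<not> ?thesis"
    then have no: False if "x \<in> A" "y \<in> A" "x \<noteq> y" "x \<in> ?r y" "y \<in> ?r x" for x y
      using that by blast
    have no': "(u, v) \<in> A \<Longrightarrow> (u + 1, v) \<in> A \<Longrightarrow> odd (u + v)"
      "(u, v) \<in> A \<Longrightarrow> (u, v + 1) \<in> A \<Longrightarrow> odd v"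
      "(u, v) \<in> A \<Longrightarrow> (u - 1, v) \<in> A \<Longrightarrow> even (u + v)"
      "(u, v) \<in> A \<Longrightarrow> (u, v - 1) \<in> A \<Longrightarrow> even v" for u v
      by (rule ccontr, erule (1) no; simp add: flip_def)+
    note nos = no'[of a b, simplified] no'[of "a + 1" b, simplified] no'[of "a - 1" b, simplified]
      no'[of a "b + 1", simplified] no'[of a "b - 1", simplified]
    show False
      by (rule disjE[OF *(3)]; rule unit_vectors_cases[OF *(1)]; rule sign_cases[OF *(2)];
          simp add: row_3 frame_map_def; insert nos; simp add: ac_simps)
  qed
qed (auto simp: card_insert_if)

section \<open>Transfer of winning to simpler sets\<close>

lemma maker_wins_simpler:
  assumes "maker_wins T" "S \<preceq> T"
  shows "maker_wins S"
  using assms copy_within_ancestor unfolding maker_wins_def simpler_def by metis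

text \<open>If \<open>T\<close> is unbounded, choosing for each member of \<open>T\<close> an
  ancestor in \<open>S\<close> gives a bounded restriction of \<open>T\<close>, because
  \<open>S\<close> has only finite members; the maker wins it and hence \<open>S\<close>.\<close>

lemma winner_simpler_maker_wins:
  assumes "winner T" "S \<preceq> T" "\<And>P. P \<in> S \<Longrightarrow> finite_poly P"
  shows "maker_wins S"
proof (cases "unbounded T")
  case True
  obtain F where F: "\<And>Q. Q \<in> T \<Longrightarrow> F Q \<in> S \<and> F Q \<sqsubseteq> Q"
    using assms(2) unfolding simpler_def by metis
  then have "bounded_restriction (F ` T) T"
    using assms(3) unfolding bounded_restriction_def by blast
  then have "maker_wins (F ` T)" using True assms(1) by (simp add: winner_def)
  moreover have "S \<preceq> F ` T" using F ancestor_refl by (auto simp: simpler_def)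
  ultimately show ?thesis by (rule maker_wins_simpler)
qed (use assms maker_wins_simpler in \<open>simp add: winner_def\<close>)

lemma finite_poly_N:
  assumes "N \<in> {N_2_1, N_2_2, N_2_3}" "P \<in> N"
  shows "finite_poly P"
proof -
  have "finite (row {0..<3})" by (simp add: row_3)
  then show ?thesis using assms cells_facts
    by (auto simp: N_2_1_def N_2_2_def N_2_3_def poly_defs(4-) S_poly_3 finite_poly_poly_of)
qed

lemma loser_above_N:
  assumes "N \<in> {N_2_1, N_2_2, N_2_3}" "N \<preceq> F"
  shows "loser F"
  using winner_simpler_maker_wins[OF _ assms(2) finite_poly_N[OF assms(1)]] assms(1)
    not_maker_wins_N_2_1 not_maker_wins_N_2_2 not_maker_wins_N_2_3 by blast

section \<open>The maker's strategy\<close>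

text \<open>A greedy strategy with goal \<open>G1\<close> before \<open>G2\<close>, both judged from
  the maker's own cells; if neither can be met, any free cell is taken, which keeps the play
  legal.\<close>

lemma priority_strategy:
  fixes G1 G2 :: "cell list \<Rightarrow> cell \<Rightarrow> bool"
  obtains \<sigma> where
    "\<And>m b. follows m b \<sigma> \<Longrightarrow> breaker_legal m b \<Longrightarrow> maker_legal m b"
    "\<And>m b n c. follows m b \<sigma> \<Longrightarrow> c \<notin> marked m b n \<Longrightarrow> G1 (map m [0..<n]) c \<Longrightarrow>
      G1 (map m [0..<n]) (m n)"
    "\<And>m b n c. follows m b \<sigma> \<Longrightarrow> c \<notin> marked m b n \<Longrightarrow> G2 (map m [0..<n]) c \<Longrightarrow>
      G1 (map m [0..<n]) (m n) \<or> G2 (map m [0..<n]) (m n)"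
proof -
  define free :: "(cell \<times> cell set) list \<Rightarrow> cell set" where
    "free h = - (\<Union>(p, B)\<in>set h. insert p B)" for h
  define C1 where "C1 h = {c \<in> free h. G1 (map fst h) c}" for h
  define C2 where "C2 h = {c \<in> free h. G2 (map fst h) c}" for h
  define pick where "pick A = (SOME c. c \<in> A)" for A :: "cell set"
  define \<sigma> where "\<sigma> h = (if C1 h \<noteq> {} then pick (C1 h) else if C2 h \<noteq> {} then pick (C2 h)
      else pick (free h))" for h
  define hist where "hist m b n = map (\<lambda>k. (m k, b k)) [0..<n]"
    for m :: "nat \<Rightarrow> cell" and b :: "nat \<Rightarrow> cell set" and n
  have free: "free (hist m b n) = - marked m b n" for m b n
    by (auto simp: free_def hist_def marked_def)
  have fst: "map fst (hist m b n) = map m [0..<n]" for m b n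
    by (simp add: hist_def comp_def)
  have pick: "pick A \<in> A" if "A \<noteq> {}" for A
    using that by (simp add: pick_def some_in_eq)
  have s1: "\<sigma> h \<in> C1 h" if "C1 h \<noteq> {}" for h
    using pick[OF that] that by (simp add: \<sigma>_def)
  have s2: "\<sigma> h \<in> C1 h \<union> C2 h" if "C2 h \<noteq> {}" for h
    using pick[of "C1 h"] pick[of "C2 h"] that by (simp add: \<sigma>_def)
  have s3: "\<sigma> h \<in> free h" if "free h \<noteq> {}" for h
  proof (cases "C1 h = {} \<and> C2 h = {}")
    case True
    then show ?thesis using pick[OF that] by (simp add: \<sigma>_def)
  next
    case False
    then have "\<sigma> h \<in> C1 h \<union> C2 h" using s1[of h] s2[of h] by blast
    then show ?thesis by (auto simp: C1_def C2_def)
  qed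
  have m: "m n = \<sigma> (hist m b n)" if "follows m b \<sigma>" for m b n
    using that unfolding follows_def hist_def by (rule spec)
  show ?thesis
  proof (rule that[of \<sigma>])
    fix m b assume f: "follows m b \<sigma>" and b: "breaker_legal m b"
    have "finite (marked m b n)" for n
      using b unfolding marked_def breaker_legal_def by (auto intro: card_ge_0_finite)
    moreover have "infinite (UNIV :: cell set)" by (simp add: finite_prod)
    ultimately have "free (hist m b n) \<noteq> {}" for n
      unfolding free by (metis Compl_empty_eq double_compl)
    from s3[OF this] have "\<sigma> (hist m b n) \<in> free (hist m b n)" for n .
    then show "maker_legal m b"
      unfolding maker_legal_def using m[OF f] free by simp
  next
    fix m b n c assume "follows m b \<sigma>" "c \<notin> marked m b n" "G1 (map m [0..<n]) c"
    then have "m n = \<sigma> (hist m b n)" "c \<in> C1 (hist m b n)"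
      using m by (simp_all add: C1_def free fst)
    then have "m n \<in> C1 (hist m b n)"
      using s1[of "hist m b n"] by auto
    then show "G1 (map m [0..<n]) (m n)"
      by (simp add: C1_def fst)
  next
    fix m b n c assume "follows m b \<sigma>" "c \<notin> marked m b n" "G2 (map m [0..<n]) c"
    then have "m n = \<sigma> (hist m b n)" "c \<in> C2 (hist m b n)"
      using m by (simp_all add: C2_def free fst)
    then have "m n \<in> C1 (hist m b n) \<union> C2 (hist m b n)"
      using s2[of "hist m b n"] by auto
    then show "G1 (map m [0..<n]) (m n) \<or> G2 (map m [0..<n]) (m n)"
      by (auto simp: C1_def C2_def fst)
  qed
qed

lemma embeds_L_corner:
  assumes "(c, d) \<in> unit_vectors" "s \<in> {1, -1}"
    "(x, y) \<in> A" "(x + c, y + d) \<in> A" "(x - s * d, y + s * c) \<in> A"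
  shows "embeds L_cells A"
  using assms(3-) by (intro embeds_frameI[OF assms(1,2), of x y]) (simp add: frame_map_def)

text \<open>The maker completes an \<^const>\<open>L2\<close> whenever he can, and otherwise prolongs a straight line.
  A line of \<open>n \<ge> 2\<close> cells has \<open>2 n\<close> lateral neighbours, each of which would complete
  an \<^const>\<open>L2\<close>. So all \<open>2 n\<close> cells marked by the breaker are lateral neighbours, and the
  continuation of the line is free.\<close>

lemma ex_line_or_L_strategy:
  obtains \<sigma> where "\<And>m b. follows m b \<sigma> \<Longrightarrow> breaker_legal m b \<Longrightarrow> maker_legal m b"
    "\<And>m b. follows m b \<sigma> \<Longrightarrow> breaker_legal m b \<Longrightarrow>
      (\<exists>n. embeds L_cells (m ` {..<n})) \<or> (\<forall>n. embeds (row {0..<int n}) (m ` {..<n}))"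
proof -
  define G1 where "G1 ms c = embeds L_cells (insert c (set ms))" for ms and c :: cell
  \<comment> \<open>After one move any neighbour qualifies; later only the reflection of the last
    but one cell in the last one, that is, the next cell of the line.\<close>
  define G2 where "G2 ms c = ((length ms = 1 \<longrightarrow> adjacent (ms ! 0) c) \<and> (length ms \<ge> 2 \<longrightarrow>
      c = (2 * fst (ms ! (length ms - 1)) - fst (ms ! (length ms - 2)),
           2 * snd (ms ! (length ms - 1)) - snd (ms ! (length ms - 2)))))" for ms and c :: cell
  obtain \<sigma> where \<sigma>: "\<And>m b. follows m b \<sigma> \<Longrightarrow> breaker_legal m b \<Longrightarrow> maker_legal m b"
    "\<And>m b n c. follows m b \<sigma> \<Longrightarrow> c \<notin> marked m b n \<Longrightarrow> G1 (map m [0..<n]) c \<Longrightarrow>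
      G1 (map m [0..<n]) (m n)"
    "\<And>m b n c. follows m b \<sigma> \<Longrightarrow> c \<notin> marked m b n \<Longrightarrow> G2 (map m [0..<n]) c \<Longrightarrow>
      G1 (map m [0..<n]) (m n) \<or> G2 (map m [0..<n]) (m n)"
    by (rule priority_strategy[of G1 G2]) blast
  show ?thesis
  proof (rule that[of \<sigma>, OF \<sigma>(1)])
    fix m b assume f: "follows m b \<sigma>" and b: "breaker_legal m b"
    have "\<forall>n. embeds (row {0..<int n}) (m ` {..<n})" if noL: "\<And>n. \<not> embeds L_cells (m ` {..<n})"
    proof -
      have img: "insert c (set (map m [0..<n])) = insert c (m ` {..<n})" for c n
        by (simp add: atLeast0LessThan)
      have "insert (m n) (set (map m [0..<n])) = m ` {..<Suc n}" for n
        by (auto simp: atLeast0LessThan lessThan_Suc)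
      then have noG1: "\<not> G1 (map m [0..<n]) (m n)" for n
        using noL by (simp add: G1_def)
      \<comment> \<open>A free cell completing an L-tromino would have been taken by the first
        priority, against \<open>noL\<close>.\<close>
      have L: "c \<in> marked m b n" if "embeds L_cells (insert c (m ` {..<n}))" for c n
        using \<sigma>(2)[OF f, of c n] noG1[of n] that unfolding G1_def img by blast
      have G2: "G2 (map m [0..<n]) (m n)" if "c \<notin> marked m b n" "G2 (map m [0..<n]) c" for c n
        using \<sigma>(3)[OF f that] noG1[of n] by simp
      have cb: "card (b n) = 2" for n using b by (simp add: breaker_legal_def)
      have fb: "finite (b n)" for n using cb[of n] by (auto intro: card_ge_0_finite)
      obtain x y where m0: "m 0 = (x, y)" by force
      \<comment> \<open>Four neighbours against two marks: one of them is free for the second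
        move.\<close>
      define N where "N = {(x + 1, y), (x - 1, y), (x, y + 1), (x, y - 1)}"
      have "card N = 4" by (simp add: N_def)
      then have "\<not> N \<subseteq> b 0" using card_mono[OF fb[of 0], of N] cb[of 0] by auto
      then obtain e where e: "e \<in> N" "e \<notin> b 0" by blast
      have "adjacent (m 0) (m 1)"
        using G2[of e 1] e by (auto simp: N_def G2_def m0 marked_def adjacent_def)
      define c d where "c = fst (m 1) - x" and "d = snd (m 1) - y"
      have "\<bar>c\<bar> + \<bar>d\<bar> = 1"
        using \<open>adjacent (m 0) (m 1)\<close> by (simp add: adjacent_def m0 c_def d_def abs_minus_commute)
      then have cd: "(c, d) \<in> unit_vectors"
        unfolding unit_vectors_def by (simp, linarith)
      define p where "p k = (x + c * int k, y + d * int k)" for k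
      \<comment> \<open>The lateral neighbours of \<open>p k\<close>, with \<open>s = 1\<close> and
        \<open>s = -1\<close> for the two sides.\<close>
      define q where "q = (\<lambda>(k, s). (x + c * int k - s * d, y + d * int k + s * c))"
      have line: "\<forall>k\<le>n. m k = p k" if "n \<ge> 1" for n
        using that
      proof (induction n rule: nat_induct_at_least)
        case base
        have "m 1 = (x + c, y + d)" by (simp add: c_def d_def)
        then show ?case by (auto simp: p_def m0 le_Suc_eq)
      next
        case (Suc n)
        let ?U = "\<Union>k<Suc n. b k"
        let ?K = "{..n} \<times> {1, -1 :: int}"
        have img_p: "m ` {..<Suc n} = p ` {..n}"
          using Suc.IH by (auto simp: lessThan_Suc_atMost)
        have mem: "p k \<in> m ` {..<Suc n}" if "k \<le> n" for k
          using that by (simp add: img_p)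
        have marked: "marked m b (Suc n) = p ` {..n} \<union> ?U"
          unfolding img_p[symmetric] by (auto simp: marked_def)
        have q_marked: "q (k, s) \<in> marked m b (Suc n)" if k: "k \<le> n" and s: "s \<in> {1, -1}" for k s
        proof (rule L, cases "k < n")
          case True
          show "embeds L_cells (insert (q (k, s)) (m ` {..<Suc n}))"
            using mem[OF k] mem[of "Suc k"] True
            by (intro embeds_L_corner[OF cd s, of "x + c * int k" "y + d * int k"])
              (simp_all add: p_def q_def algebra_simps)
        next
          case False
          then have "k = n" using k by simp
          \<comment> \<open>The last cell has no successor, so its predecessor is the other arm;
            reversing direction and orientation together leaves the lateral cell unchanged.\<close>
          have cd': "(- c, - d) \<in> unit_vectors" "- s \<in> {1, -1}"
            using cd s by (auto simp: unit_vectors_def)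
          show "embeds L_cells (insert (q (k, s)) (m ` {..<Suc n}))"
            using mem[OF k] mem[of "n - 1"] Suc.hyps \<open>k = n\<close>
            by (intro embeds_L_corner[OF cd', of "x + c * int k" "y + d * int k"])
              (simp_all add: p_def q_def of_nat_diff algebra_simps)
        qed
        have "q (k, s) \<notin> p ` {..n}" if "s \<in> {1, -1}" for k s
          using cd that by (elim unit_vectors_cases) (auto simp: p_def q_def)
        then have sub: "q ` ?K \<subseteq> ?U"
          using q_marked marked by auto
        \<comment> \<open>The count is tight: \<open>2 * Suc n\<close> distinct lateral cells lie in
          \<open>Suc n\<close> replies of two cells each. So the replies contain nothing else, and
          the next cell of the line is free.\<close>
        have "inj_on q ?K"
          using cd by (elim unit_vectors_cases) (auto simp: q_def inj_on_def)
        then have "card (q ` ?K) = 2 * Suc n"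
          by (simp add: card_image card_cartesian_product)
        moreover have "card ?U \<le> 2 * Suc n"
          using card_UN_le[of "{..<Suc n}" b] by (simp add: cb)
        ultimately have "q ` ?K = ?U"
          using sub fb by (intro card_seteq) auto
        moreover have "p (Suc n) \<notin> q ` ?K"
          using cd by (elim unit_vectors_cases) (auto simp: p_def q_def)
        moreover have "p (Suc n) \<notin> p ` {..n}"
          using cd by (elim unit_vectors_cases) (auto simp: p_def)
        ultimately have "p (Suc n) \<notin> marked m b (Suc n)"
          using marked by simp
        moreover have G2_iff: "G2 (map m [0..<Suc n]) z \<longleftrightarrow> z = p (Suc n)" for z
        proof -
          have "m n = p n" "m (n - 1) = p (n - 1)" using Suc.IH by simp_all
          then show ?thesis using Suc.hyps
            by (auto simp: G2_def nth_append p_def of_nat_diff algebra_simps)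
        qed
        ultimately have "m (Suc n) = p (Suc n)" using G2[of "p (Suc n)" "Suc n"] by blast
        then show ?case using Suc.IH by (auto simp: le_Suc_eq)
      qed
      have m: "m k = p k" for k using line[of "Suc k"] by simp
      show ?thesis
      proof
        fix n
        show "embeds (row {0..<int n}) (m ` {..<n})"
        proof (rule embeds_frameI[OF cd, of 1 x y])
          have "(x + c * i, y + d * i) = m (nat i)" "nat i < n" if "0 \<le> i" "i < int n" for i
            using that by (simp_all only: m p_def nat_less_iff int_nat_eq if_True)
          then show "frame_map x y c d 1 ` row {0..<int n} \<subseteq> m ` {..<n}"
            unfolding frame_map_row by clarsimp
        qed simp
      qed
    qed
    then show "(\<exists>n. embeds L_cells (m ` {..<n})) \<or> (\<forall>n. embeds (row {0..<int n}) (m ` {..<n}))"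
      by blast
  qed
qed

section \<open>Sets simpler than \<open>Y_2\<close>\<close>

lemma finite_ancestor_S_inf:
  assumes "finite_poly P" "P \<sqsubseteq> S_inf"
  shows "\<exists>n\<ge>1. P \<sqsubseteq> S_poly n"
proof -
  obtain X where X: "poly_cells X" "P = poly_of X" by (rule polyomino_cases)
  have "finite X" using assms(1) X by (simp add: finite_poly_poly_of)
  obtain f where f: "board_symmetry f" "f ` X \<subseteq> row {0..}"
    using assms(2) X cells_facts by (auto simp: poly_defs(2) ancestor_poly_of embeds_def)
  obtain u where u: "\<And>i. i \<in> fst ` f ` X \<Longrightarrow> i \<le> u"
    using \<open>finite X\<close> by (meson Max_ge finite_imageI)
  have "f ` X \<subseteq> row {0..<int (Suc (nat u))}"
  proof
    fix z assume z: "z \<in> f ` X"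
    then have "fst z \<le> u" using u by blast
    then show "z \<in> row {0..<int (Suc (nat u))}" using z f(2) by (force simp: row_def)
  qed
  then have "P \<sqsubseteq> S_poly (Suc (nat u))"
    using X f(1) cells_facts(1)[of "Suc (nat u)"]
    by (simp add: poly_defs(1) ancestor_poly_of embedsI del: of_nat_Suc)
  then show ?thesis by (intro exI[of _ "Suc (nat u)"]) simp
qed

text \<open>One strategy serves for all lengths: either an L-tromino appears and contains a copy of
  \<open>Q\<close>, or the line becomes long enough for the finite \<open>P\<close>.\<close>

lemma maker_wins_line_L:
  assumes "P \<in> R" "finite_poly P" "P \<sqsubseteq> S_inf" "Q \<in> R" "Q \<sqsubseteq> L2"
  shows "maker_wins R"
proof -
  obtain n where n: "n \<ge> 1" "P \<sqsubseteq> S_poly n" using finite_ancestor_S_inf[OF assms(2,3)] by blast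
  obtain \<sigma> where \<sigma>: "\<And>m b. follows m b \<sigma> \<Longrightarrow> breaker_legal m b \<Longrightarrow> maker_legal m b"
    "\<And>m b. follows m b \<sigma> \<Longrightarrow> breaker_legal m b \<Longrightarrow>
      (\<exists>n. embeds L_cells (m ` {..<n})) \<or> (\<forall>n. embeds (row {0..<int n}) (m ` {..<n}))"
    by (rule ex_line_or_L_strategy) blast
  have L: "copy_within Q A" if "embeds L_cells A" for A
    using that poly_cells_L2 assms(5)
    by (intro copy_within_ancestor[OF assms(5)]) (simp add: poly_defs copy_within_poly_of)
  have S: "copy_within P A" if "embeds (row {0..<int n}) A" for A
    using that cells_facts(1)[OF n(1)]
    by (intro copy_within_ancestor[OF n(2)]) (simp add: poly_defs(1) copy_within_poly_of)
  show ?thesis unfolding maker_wins_def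
  proof (intro exI[of _ \<sigma>] allI impI conjI; elim conjE)
    fix m b assume "follows m b \<sigma>" "breaker_legal m b"
    then show "maker_legal m b" "\<exists>n. \<exists>P\<in>R. copy_within P (m ` {..<n})"
      using \<sigma> L S assms(1,4) by metis+
  qed
qed

text \<open>Ancestors of \<open>S_inf\<close> and \<open>L2\<close> in \<open>F\<close> are replaced
  by their own ancestors in a bounded restriction, so \<open>maker_wins_line_L\<close> applies to it
  as well.\<close>

lemma winner_if_simpler_Y_2:
  assumes "F \<preceq> Y_2"
  shows "winner F"
proof -
  obtain P Q where PQ: "P \<in> F" "P \<sqsubseteq> S_inf" "Q \<in> F" "Q \<sqsubseteq> L2"
    using assms by (auto simp: simpler_def Y_2_def)
  show ?thesis
  proof (cases "unbounded F")
    case True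
    have "maker_wins R" if R: "bounded_restriction R F" for R
    proof -
      obtain G where G: "\<And>P. P \<in> F \<Longrightarrow> finite_poly (G P) \<and> G P \<sqsubseteq> P" "R = G ` F"
        using R unfolding bounded_restriction_def by blast
      show ?thesis
        using G PQ by (intro maker_wins_line_L[of "G P" R "G Q"]) (auto intro: ancestor_trans)
    qed
    then show ?thesis using True by (simp add: winner_def)
  next
    case False
    then have "finite_poly P" using PQ(1) by (auto simp: unbounded_def)
    then show ?thesis using maker_wins_line_L[OF PQ(1) _ PQ(2-)] False by (simp add: winner_def)
  qed
qed

section \<open>Polyominoes without an L-tromino\<close>

lemma adjacent_iff:
  "adjacent (a, b) (x, y) \<longleftrightarrow> (x, y) \<in> {(a + 1, b), (a - 1, b), (a, b + 1), (a, b - 1)}"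
  unfolding adjacent_def by (simp, linarith)

text \<open>Connectedness as an induction along paths, the form in which it is used below.\<close>

lemma poly_cells_invariant:
  assumes "poly_cells X" "p \<in> X" "\<Phi> p" "q \<in> X"
    and step: "\<And>u v. u \<in> X \<Longrightarrow> v \<in> X \<Longrightarrow> adjacent u v \<Longrightarrow> \<Phi> u \<Longrightarrow> \<Phi> v"
  shows "\<Phi> q"
proof -
  have "(p, q) \<in> {(u, v). u \<in> X \<and> v \<in> X \<and> adjacent u v}\<^sup>*"
    using assms(1,2,4) by (auto simp: poly_cells_def cell_connected_def)
  then show ?thesis
    by (induction rule: rtrancl_induct) (use assms(3) step in auto)
qed

lemma adjacent_frame_map:
  assumes "(c, d) \<in> unit_vectors" "s \<in> {1, -1}"
  shows "adjacent (frame_map a b c d s p) (frame_map a b c d s q) \<longleftrightarrow> adjacent p q"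
proof -
  obtain x y x' y' where pq: "p = (x, y)" "q = (x', y')" by (metis surj_pair)
  show ?thesis
    by (rule unit_vectors_cases[OF assms(1)]; rule sign_cases[OF assms(2)])
      (simp_all add: frame_map_def adjacent_def pq, linarith+)
qed

lemma poly_cells_image:
  assumes "poly_cells X" "board_symmetry f"
  shows "poly_cells (f ` X)"
proof -
  obtain a b c d s where f: "(c, d) \<in> unit_vectors" "s \<in> {1, -1}" "f = frame_map a b c d s"
    using board_symmetry_imp_frame_map[OF assms(2)] by metis
  let ?E = "\<lambda>X. {(u, v). u \<in> X \<and> v \<in> X \<and> adjacent u v}"
  have "(f p, f q) \<in> (?E (f ` X))\<^sup>*" if "(p, q) \<in> (?E X)\<^sup>*" for p q
    using that
  proof (induction rule: rtrancl_induct)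
    case (step u v)
    then have "(f u, f v) \<in> ?E (f ` X)" by (auto simp: f(3) adjacent_frame_map[OF f(1,2)])
    with step.IH show ?case by (rule rtrancl_into_rtrancl)
  qed simp
  then show ?thesis using assms(1) by (auto simp: poly_cells_def cell_connected_def)
qed

lemma subset_row_eq: "X \<subseteq> row UNIV \<Longrightarrow> X = row {i. (i, 0) \<in> X}"
  by (auto simp: row_def)

lemma subset_row_if_no_L:
  assumes X: "poly_cells X" "\<not> embeds L_cells X" "(0, 0) \<in> X" "(1, 0) \<in> X"
  shows "X \<subseteq> row UNIV"
proof
  \<comment> \<open>The second conjunct carries along a horizontal neighbour, the arm that would
    turn a step off the axis into an L-tromino.\<close>
  define \<Phi> where "\<Phi> = (\<lambda>(x, y :: int). y = 0 \<and> ((x - 1, 0) \<in> X \<or> (x + 1, 0) \<in> X))"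
  fix q assume "q \<in> X"
  have "\<Phi> q"
  proof (rule poly_cells_invariant[OF X(1,3) _ \<open>q \<in> X\<close>])
    show "\<Phi> (0, 0)" using X(4) by (simp add: \<Phi>_def)
    fix u v assume uv: "u \<in> X" "v \<in> X" "adjacent u v" "\<Phi> u"
    obtain x y x' y' where xy: "u = (x, y)" "v = (x', y')" by (metis surj_pair)
    obtain e where e: "e \<in> {1, -1}" "(x + e, 0) \<in> X" and y: "y = 0"
      using uv(4) by (force simp: \<Phi>_def xy)
    have "y' = 0"
    proof (rule ccontr)
      assume "y' \<noteq> 0"
      then have y': "y' \<in> {1, -1}" "x' = x"
        using uv(3) by (auto simp: adjacent_def xy y abs_if split: if_splits)
      \<comment> \<open>For direction \<open>(e, 0)\<close> and orientation \<open>s\<close> the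
        lateral cell has height \<open>s * e\<close>, so \<open>s = e * y'\<close> puts it at height
        \<open>y'\<close>.\<close>
      have ey: "(e, 0) \<in> unit_vectors" "e * y' \<in> {1, -1}" "e * y' * e = y'"
        using e(1) y'(1) by (auto simp: unit_vectors_def)
      have "(x - e * y' * 0, 0 + e * y' * e) \<in> X"
        using uv(2) unfolding ey(3) by (simp add: xy y'(2))
      then have "embeds L_cells X"
        using uv(1) e(2) by (intro embeds_L_corner[OF ey(1,2), of x 0]) (simp_all add: xy y)
      then show False using X(2) by simp
    qed
    then have "x = x' - 1 \<or> x = x' + 1"
      using uv(3) by (auto simp: adjacent_def xy y abs_if split: if_splits)
    then show "\<Phi> v" using uv(1) \<open>y' = 0\<close> by (auto simp: \<Phi>_def xy y)
  qed
  then show "q \<in> row UNIV" by (auto simp: \<Phi>_def row_def)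
qed

text \<open>An adjacent pair is moved to \<open>(0, 0)\<close> and \<open>(1, 0)\<close>, which
  fixes the line; without such a pair connectedness leaves a single cell.\<close>

lemma congruent_row_if_no_L:
  assumes X: "poly_cells X" "\<not> embeds L_cells X"
  shows "\<exists>I. congruent_cells X (row I)"
proof (cases "\<exists>u\<in>X. \<exists>v\<in>X. adjacent u v")
  case True
  then obtain a b a' b' where uv: "(a, b) \<in> X" "(a', b') \<in> X" "adjacent (a, b) (a', b')" by force
  have u: "(a' - a, b' - b) \<in> unit_vectors" "(1 :: int) \<in> {1, -1}"
    using uv(3) by (auto simp: adjacent_def unit_vectors_def abs_if split: if_splits)
  let ?g = "frame_map a b (a' - a) (b' - b) 1"
  obtain f where f: "board_symmetry f" "f \<circ> ?g = id" "?g \<circ> f = id"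
    using board_symmetry_inverse[OF board_symmetry_frame_map[OF u, of a b]] by metis
  have "?g (0, 0) = (a, b)" "?g (1, 0) = (a', b')" by (simp_all add: frame_map_def)
  then have "f (a, b) = (0, 0)" "f (a', b') = (1, 0)"
    using f(2) by (metis comp_apply id_apply)+
  then have mem: "(0, 0) \<in> f ` X" "(1, 0) \<in> f ` X"
    using uv(1,2) by (metis imageI)+
  have "\<not> embeds L_cells (f ` X)"
  proof
    assume "embeds L_cells (f ` X)"
    moreover have "congruent_cells (f ` X) X"
      using congruent_cells_sym[OF congruent_cells_image[OF f(1)]] .
    ultimately show False using X(2) embeds_trans congruent_imp_embeds by blast
  qed
  from subset_row_if_no_L[OF poly_cells_image[OF X(1) f(1)] this mem]
  have "f ` X = row {i. (i, 0) \<in> f ` X}" by (rule subset_row_eq)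
  then show ?thesis using congruent_cells_image[OF f(1)] by metis
next
  case False
  obtain a b where p: "(a, b) \<in> X" using X(1) by (force simp: poly_cells_def)
  have "q = (a, b)" if "q \<in> X" for q
    using poly_cells_invariant[OF X(1) p, of "\<lambda>q. q = (a, b)"] that False by blast
  then have "X = {(a, b)}" using p by blast
  then have "row {0} = (\<lambda>(x, y). (x + (- a), y + (- b))) ` X" by (simp add: row_def)
  then show ?thesis using translation unfolding congruent_cells_def by blast
qed

section \<open>Classification of straight polyominoes\<close>

lemma poly_cells_row_convex:
  assumes "poly_cells (row I)" "i \<in> I" "k \<in> I" "i \<le> j" "j \<le> k"
  shows "j \<in> I"
proof (rule ccontr)
  assume j: "j \<notin> I"
  \<comment> \<open>Unit steps cannot jump over the missing index \<open>j\<close>, so every cell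
    connected to \<open>i\<close> stays to its left.\<close>
  have "fst (k, 0 :: int) < j"
  proof (rule poly_cells_invariant[OF assms(1), of "(i, 0)" "\<lambda>p. fst p < j"])
    show "(i, 0) \<in> row I" "(k, 0) \<in> row I" using assms by (auto simp: row_def)
    show "fst (i, 0 :: int) < j" using assms(2,4) j by (cases "i = j") auto
    fix u v assume uv: "u \<in> row I" "v \<in> row I" "adjacent u v" "fst u < j"
    then have "fst v \<noteq> j" using j by (auto simp: row_def)
    then show "fst v < j" using uv by (auto simp: row_def adjacent_def)
  qed
  then show False using assms(5) by simp
qed

lemma congruent_rows:
  assumes "e \<in> {1, -1}" "\<And>j. j \<in> J \<longleftrightarrow> e * (j - a) \<in> I"
  shows "congruent_cells (row I) (row J)"
proof -
  have "(e, 0) \<in> unit_vectors" using assms(1) by (auto simp: unit_vectors_def)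
  moreover have "row J = frame_map a 0 e 0 1 ` row I"
  proof -
    have "j \<in> J \<longleftrightarrow> (\<exists>i. j = a + e * i \<and> i \<in> I)" for j
    proof
      assume "j \<in> J"
      moreover have "j = a + e * (e * (j - a))" using assms(1) by auto
      ultimately show "\<exists>i. j = a + e * i \<and> i \<in> I" using assms(2) by blast
    next
      assume "\<exists>i. j = a + e * i \<and> i \<in> I"
      then obtain i where i: "j = a + e * i" "i \<in> I" by blast
      then have "e * (j - a) = i" using assms(1) by auto
      then show "j \<in> J" using assms(2) i(2) by blast
    qed
    then show ?thesis unfolding frame_map_row by (auto simp: row_def)
  qed
  ultimately show ?thesis
    unfolding congruent_cells_def using board_symmetry_frame_map by blast
qed

lemma int_ex_least:
  fixes I :: "int set"
  assumes "i \<in> I" "\<forall>i\<in>I. l \<le> i"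
  obtains m where "m \<in> I" "\<And>i. i \<in> I \<Longrightarrow> m \<le> i"
proof -
  obtain m where m: "m \<in> I" "\<And>i. i \<in> I \<Longrightarrow> nat (m - l) \<le> nat (i - l)"
    using ex_has_least_nat[of "\<lambda>i. i \<in> I" i "\<lambda>i. nat (i - l)"] assms(1) by blast
  have "m \<le> i" if "i \<in> I" for i using m(2)[OF that] assms(2) that by force
  then show ?thesis using that m(1) by blast
qed

lemma int_ex_greatest:
  fixes I :: "int set"
  assumes "i \<in> I" "\<forall>i\<in>I. i \<le> u"
  obtains m where "m \<in> I" "\<And>i. i \<in> I \<Longrightarrow> i \<le> m"
proof -
  have "- i \<in> uminus ` I" "\<forall>i\<in>uminus ` I. - u \<le> i" using assms by auto
  then obtain m where "m \<in> uminus ` I" "\<And>i. i \<in> uminus ` I \<Longrightarrow> m \<le> i"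
    by (rule int_ex_least) blast
  then have "- m \<in> I" "i \<le> - m" if "i \<in> I" for i
    using that by force+
  then show ?thesis using that assms(1) by blast
qed

text \<open>By convexity \<open>I\<close> is an interval, a ray or everything, depending on which
  bounds exist; a ray to the left becomes \<open>S_inf\<close> by a reflection.\<close>

lemma row_cases:
  assumes "poly_cells (row I)"
  shows "poly_of (row I) \<in> {S_inf, S_biinf} \<union> {S_poly n | n. n \<ge> 1}"
proof -
  obtain i where i: "i \<in> I" using assms by (auto simp: poly_cells_def row_def)
  note convex = poly_cells_row_convex[OF assms]
  have half: "poly_of (row I) = S_inf" if "e \<in> {1, -1}" "\<And>j. j \<in> {0..} \<longleftrightarrow> e * (j - a) \<in> I" for a e
    using poly_of_eqI[OF assms cells_facts(2) congruent_rows[OF that]] by (simp add: poly_defs)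
  show ?thesis
  proof (cases "\<exists>l. \<forall>i\<in>I. l \<le> i"; cases "\<exists>u. \<forall>i\<in>I. i \<le> u")
    assume "\<exists>l. \<forall>i\<in>I. l \<le> i" and u: "\<exists>u. \<forall>i\<in>I. i \<le> u"
    then obtain l where l: "l \<in> I" "\<And>i. i \<in> I \<Longrightarrow> l \<le> i" by (elim exE int_ex_least[OF i]) blast
    from u obtain u where u: "u \<in> I" "\<And>i. i \<in> I \<Longrightarrow> i \<le> u" by (elim exE int_ex_greatest[OF i]) blast
    note lu = l(1) u(1) l(2) u(2)
    define n where "n = nat (u - l + 1)"
    have n: "n \<ge> 1" "int n = u - l + 1" using lu(3)[OF lu(2)] by (simp_all add: n_def)
    have "I = {l..u}"
      using lu(3,4) convex[OF lu(1,2)] by (intro set_eqI) (metis atLeastAtMost_iff)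
    then have "j \<in> {0..<int n} \<longleftrightarrow> 1 * (j - (- l)) \<in> I" for j by (auto simp: n(2))
    from poly_of_eqI[OF assms cells_facts(1)[OF n(1)] congruent_rows[OF _ this]]
    have "poly_of (row I) = S_poly n" by (simp add: poly_defs)
    then show ?thesis using n(1) by blast
  next
    assume "\<exists>l. \<forall>i\<in>I. l \<le> i" and u: "\<not> (\<exists>u. \<forall>i\<in>I. i \<le> u)"
    then obtain l where l: "l \<in> I" "\<And>i. i \<in> I \<Longrightarrow> l \<le> i" by (elim exE int_ex_least[OF i]) blast
    have "j \<in> I" if "l \<le> j" for j
      using u convex[OF l(1) _ that] by (meson linear)
    then have "I = {l..}" using l(2) by auto
    then show ?thesis using half[of 1 "- l"] by simp
  next
    assume l: "\<not> (\<exists>l. \<forall>i\<in>I. l \<le> i)" and "\<exists>u. \<forall>i\<in>I. i \<le> u"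
    then obtain u where u: "u \<in> I" "\<And>i. i \<in> I \<Longrightarrow> i \<le> u" by (elim exE int_ex_greatest[OF i]) blast
    have "j \<in> I" if "j \<le> u" for j
      using l convex[OF _ u(1) _ that] by (meson linear)
    then have "I = {..u}" using u(2) by auto
    then show ?thesis using half[of "-1" u] by simp
  next
    assume "\<not> (\<exists>l. \<forall>i\<in>I. l \<le> i)" "\<not> (\<exists>u. \<forall>i\<in>I. i \<le> u)"
    then have "I = UNIV" using convex by (metis UNIV_eq_I linear)
    then show ?thesis by (simp add: poly_defs)
  qed
qed

definition straight :: "polyomino set" where
  "straight = {S_inf, S_biinf} \<union> {S_poly n | n. n \<ge> 1}"

lemma straight_if_no_L2:
  assumes "\<not> L2 \<sqsubseteq> P"
  shows "P \<in> straight"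
proof -
  obtain X where X: "poly_cells X" "P = poly_of X" by (rule polyomino_cases)
  then have "\<not> embeds L_cells X"
    using assms cells_facts by (simp add: poly_defs ancestor_poly_of)
  then obtain I where I: "congruent_cells X (row I)" using congruent_row_if_no_L X(1) by blast
  then have "poly_cells (row I)"
    using poly_cells_image[OF X(1)] by (auto simp: congruent_cells_def)
  then show ?thesis using poly_of_eqI[OF X(1) _ I] row_cases X(2) by (simp add: straight_def)
qed

lemma row_ancestor: "poly_cells (row I) \<Longrightarrow> poly_cells (row J) \<Longrightarrow> I \<subseteq> J \<Longrightarrow> poly_of (row I) \<sqsubseteq> poly_of (row J)"
  by (auto simp: ancestor_poly_of row_def intro!: embeds_subset)

lemma straight_ancestors:
  "m \<ge> 1 \<Longrightarrow> m \<le> n \<Longrightarrow> S_poly m \<sqsubseteq> S_poly n" "m \<ge> 1 \<Longrightarrow> S_poly m \<sqsubseteq> S_inf"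
  "m \<ge> 1 \<Longrightarrow> S_poly m \<sqsubseteq> S_biinf" "S_inf \<sqsubseteq> S_biinf"
  unfolding poly_defs by (rule row_ancestor; auto intro: cells_facts)+

text \<open>Finite lines, the half-line and the full line form an increasing chain, so a team has at
  most one straight member.\<close>

lemma straight_comparable:
  assumes "P \<in> straight" "Q \<in> straight"
  shows "P \<sqsubseteq> Q \<or> Q \<sqsubseteq> P"
proof -
  have "S_poly m \<sqsubseteq> S_poly n \<or> S_poly n \<sqsubseteq> S_poly m" if "m \<ge> 1" "n \<ge> 1" for m n
    using that straight_ancestors(1) by (meson linear)
  then show ?thesis
    using assms straight_ancestors(2-) ancestor_refl unfolding straight_def by auto
qed

section \<open>Classification of teams of size two\<close>

lemma S_poly_ancestor_L2:
  assumes "n \<ge> 1" "n \<le> 2"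
  shows "S_poly n \<sqsubseteq> L2"
proof -
  have "row {0..<int n} \<subseteq> L_cells" using assms(2) by (auto simp: row_def)
  then show ?thesis
    using assms(1) cells_facts by (simp add: poly_defs ancestor_poly_of embeds_subset)
qed

text \<open>With the L-tromino in standard position, connectedness gives a further cell touching it.
  Of the seven candidates four complete a row of three, one the square and two a copy of
  \<open>Z2\<close>.\<close>

lemma proper_L2_descendant:
  assumes "L2 \<sqsubseteq> Q" "Q \<noteq> L2"
  shows "S_poly 3 \<sqsubseteq> Q \<or> C2 \<sqsubseteq> Q \<or> Z2 \<sqsubseteq> Q"
proof -
  obtain X where X: "poly_cells X" "Q = poly_of X" by (rule polyomino_cases)
  then have "embeds L_cells X" using assms(1) cells_facts by (simp add: poly_defs ancestor_poly_of)
  then obtain g where g: "board_symmetry g" "g ` L_cells \<subseteq> X" by (auto simp: embeds_def)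
  obtain f where f: "board_symmetry f" "f \<circ> g = id" using board_symmetry_inverse[OF g(1)] by blast
  define Y where "Y = f ` X"
  have Y: "poly_cells Y" "congruent_cells X Y"
    unfolding Y_def using X(1) f(1) by (simp_all add: poly_cells_image congruent_cells_image)
  then have Q: "Q = poly_of Y" using poly_of_eqI X by blast
  have "f ` g ` L_cells = L_cells" by (simp only: image_comp f(2) image_id id_apply)
  then have L: "L_cells \<subseteq> Y" using g(2) unfolding Y_def by blast
  have "\<exists>v\<in>Y - L_cells. \<exists>u\<in>L_cells. adjacent u v"
  proof (rule ccontr)
    assume "\<not> ?thesis"
    then have "q \<in> L_cells" if "q \<in> Y" for q
      using poly_cells_invariant[OF Y(1), of "(0, 0)" "\<lambda>u. u \<in> L_cells" q] that L by blast
    then have "Y = L_cells" using L by blast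
    then show False using Q assms(2) by (simp add: poly_defs)
  qed
  then obtain x y u where v: "(x, y) \<in> Y" "(x, y) \<notin> L_cells" "u \<in> L_cells" "adjacent u (x, y)"
    by force
  have "(x, y) \<in> {(-1, 0), (0, -1), (2, 0), (1, 1), (1, -1), (-1, 1), (0, 2)}"
    using v(3,4,2) by (elim insertE emptyE; simp add: adjacent_iff; elim disjE; simp)
  then have "embeds (row {0..<3}) Y \<or> embeds C_cells Y \<or> embeds Z_cells Y"
  proof (elim insertE emptyE)
    assume "(x, y) = (-1, 0)"
    then have "frame_map (-1) 0 1 0 1 ` row {0..<3} \<subseteq> Y"
      using v(1) L by (simp add: row_3 frame_map_def)
    then have "embeds (row {0..<3}) Y"
      by (rule embeds_frameI[rotated 2]) (simp_all add: unit_vectors_def)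
    then show ?thesis by simp
  next
    assume "(x, y) = (0, -1)"
    then have "frame_map 0 (-1) 0 1 1 ` row {0..<3} \<subseteq> Y"
      using v(1) L by (simp add: row_3 frame_map_def)
    then have "embeds (row {0..<3}) Y"
      by (rule embeds_frameI[rotated 2]) (simp_all add: unit_vectors_def)
    then show ?thesis by simp
  next
    assume "(x, y) = (2, 0)"
    then have "row {0..<3} \<subseteq> Y" using v(1) L by (simp add: row_3)
    then show ?thesis using embeds_subset by blast
  next
    assume "(x, y) = (1, 1)"
    then have "C_cells \<subseteq> Y" using v(1) L by simp
    then show ?thesis using embeds_subset by blast
  next
    assume "(x, y) = (1, -1)"
    then have "Z_cells \<subseteq> Y" using v(1) L by simp
    then show ?thesis using embeds_subset by blast
  next
    assume "(x, y) = (-1, 1)"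
    \<comment> \<open>This symmetry exchanges the two coordinates.\<close>
    then have "frame_map 0 0 0 1 (-1) ` Z_cells \<subseteq> Y"
      using v(1) L by (simp add: frame_map_def)
    then have "embeds Z_cells Y"
      by (rule embeds_frameI[rotated 2]) (simp_all add: unit_vectors_def)
    then show ?thesis by simp
  next
    assume "(x, y) = (0, 2)"
    then have "frame_map 0 0 0 1 1 ` row {0..<3} \<subseteq> Y"
      using v(1) L by (simp add: row_3 frame_map_def)
    then have "embeds (row {0..<3}) Y"
      by (rule embeds_frameI[rotated 2]) (simp_all add: unit_vectors_def)
    then show ?thesis by simp
  qed
  then show ?thesis
    using Y(1) cells_facts unfolding Q by (simp add: S_poly_3 poly_defs(5,6) ancestor_poly_of)
qed

text \<open>Lines of at most two cells are ancestors of \<open>L2\<close> and so of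
  \<open>Q\<close>; hence \<open>P\<close> contains \<open>S_poly 3\<close>. If
  \<open>Q = L2\<close>, excluding \<open>S_biinf\<close> leaves \<open>P\<close> an ancestor of
  \<open>S_inf\<close>; otherwise \<open>Q\<close> contains a row of three, \<open>C2\<close> or
  \<open>Z2\<close>.\<close>

lemma straight_L2_team:
  assumes "P \<in> straight" "L2 \<sqsubseteq> Q" "\<not> P \<sqsubseteq> Q" "{P, Q} \<noteq> {S_biinf, L2}"
  shows "{P, Q} \<preceq> Y_2 \<or> N_2_2 \<preceq> {P, Q} \<or> N_2_3 \<preceq> {P, Q}"
proof -
  have "n \<ge> 3" if "P = S_poly n" "n \<ge> 1" for n
    using S_poly_ancestor_L2[of n] ancestor_trans[of P L2 Q] assms(2,3) that by (cases "n \<le> 2") auto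
  then have S3: "S_poly 3 \<sqsubseteq> P"
    using assms(1) straight_ancestors(1)[of 3] straight_ancestors(2,3)[of 3] by (auto simp: straight_def)
  show ?thesis
  proof (cases "Q = L2")
    case True
    then have "P \<sqsubseteq> S_inf"
      using assms(1,4) straight_ancestors(2) ancestor_refl by (auto simp: straight_def)
    then show ?thesis using True ancestor_refl by (auto simp: simpler_def Y_2_def)
  next
    case False
    then show ?thesis
      using proper_L2_descendant[OF assms(2)] S3 by (auto simp: simpler_def N_2_2_def N_2_3_def)
  qed
qed

text \<open>Two straight members would be comparable, so at most one member avoids
  \<open>L2\<close>; if none does, \<open>N_2_1\<close> is simpler than \<open>F\<close>.\<close>

lemma two_team_cases:
  assumes "team F" "card F = 2" "F \<noteq> {S_biinf, L2}"
  shows "F \<preceq> Y_2 \<or> (\<exists>N\<in>{N_2_1, N_2_2, N_2_3}. N \<preceq> F)"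
proof -
  obtain P Q where F: "F = {P, Q}" "P \<noteq> Q" using assms(2) by (auto simp: card_2_iff)
  then have nc: "\<not> P \<sqsubseteq> Q" "\<not> Q \<sqsubseteq> P" using assms(1) by (auto simp: team_def)
  consider "L2 \<sqsubseteq> P" "L2 \<sqsubseteq> Q" | "P \<in> straight" "L2 \<sqsubseteq> Q" | "Q \<in> straight" "L2 \<sqsubseteq> P"
    using straight_if_no_L2 straight_comparable nc by blast
  then show ?thesis
  proof cases
    case 1
    then show ?thesis by (simp add: F(1) simpler_def N_2_1_def)
  next
    case 2
    then show ?thesis using straight_L2_team[of P Q] nc assms(3) F(1) by auto
  next
    case 3
    have "F = {Q, P}" using F(1) by blast
    then show ?thesis using straight_L2_team[of Q P] 3 nc assms(3) by auto
  qed
qed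

lemma teams: "team Y_2" "\<forall>N\<in>{N_2_1, N_2_2, N_2_3}. team N"
proof -
  have L_row: "\<not> embeds L_cells (row I)" for I
    by (rule notI, elim embedsE unit_vectors_cases sign_cases) (auto simp: frame_map_def row_def)
  have CZ_row: "\<not> embeds C_cells (row I)" "\<not> embeds Z_cells (row I)" for I
    by (rule notI; elim embedsE unit_vectors_cases sign_cases; auto simp: frame_map_def row_def)+
  have row_LCZ: "\<not> embeds (row {0..<3}) L_cells" "\<not> embeds (row {0..<3}) C_cells"
    "\<not> embeds (row {0..<3}) Z_cells"
    by (rule notI; elim embedsE unit_vectors_cases; simp add: frame_map_def row_3;
        elim conjE disjE; simp)+
  have "row {0..<3} \<subseteq> row {0..}" by (auto simp: row_def)
  then have "\<not> embeds (row {0..}) L_cells"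
    using row_LCZ(1) embeds_subset embeds_trans by blast
  then show "team Y_2"
    using L_row cells_facts by (auto simp: team_def Y_2_def poly_defs ancestor_poly_of)
  show "\<forall>N\<in>{N_2_1, N_2_2, N_2_3}. team N"
    using CZ_row row_LCZ cells_facts
    by (auto simp: team_def N_2_1_def N_2_2_def N_2_3_def poly_defs(4-) S_poly_3 ancestor_poly_of)
qed

lemma simpler_refl: "S \<preceq> S"
  using ancestor_refl by (auto simp: simpler_def)

text \<open>In the final equivalence a winner cannot lie above a losing set, so the first
  alternative remains; the converse is the maker's strategy. Reflexivity of \<open>\<preceq>\<close>
  settles \<open>Y_2\<close> and the sets \<open>N\<close> themselves.\<close>

theorem proposition6p2:
  "(team Y_2 \<and> winner Y_2) \<and>
   (\<forall>N \<in> {N_2_1, N_2_2, N_2_3}. team N \<and> loser N) \<and>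
   (\<forall>F. team F \<and> card F = 2 \<and> F \<noteq> {S_biinf, L2} \<longrightarrow>
      (F \<preceq> Y_2 \<or> (\<exists>N \<in> {N_2_1, N_2_2, N_2_3}. N \<preceq> F)) \<and>
      (winner F \<longleftrightarrow> F \<preceq> Y_2))"
  using teams winner_if_simpler_Y_2 loser_above_N simpler_refl two_team_cases by metis

end
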